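(* Let $E\subset\mathbb{R}^d$ be a Lebesgue measurable set with $E=-E$ and Lebesgue measure $|E|=1$, and let $\mathsf{K}$ be the determinantal point process associated with the projection kernel $K(x)=\int_E e^{2\pi \mathrm{i}\, x\cdot\xi}\,\mathrm{d}\xi$, i.e. the stationary point process on $\mathbb{R}^d$ with correlation functions $\rho^{(n)}(x_1,\dots,x_n)=\det[K(x_i-x_j)]_{i,j=1}^n$, $n\in\mathbb{N}$. Then the structure factor $S$ of $\mathsf{K}$ is given by $$S(\xi)=1-\bigl|(E+\xi)\cap E\bigr|,\qquad \xi\in\mathbb{R}^d.$$ In particular, $S(0)=0$, while $S(\xi)>0$ for all $\xi\neq 0$.
   Context: $|\cdot|$ denotes Lebesgue measure. $\Gamma$ is the set of locally finite subsets $\gamma\subset\mathbb{R}^d$, with the $\sigma$-algebra generated by the counting maps $\gamma\mapsto\#(\gamma\cap\triangle)$, $\triangle\subset\mathbb{R}^d$ bounded (Borel); a point process is a probability measure on $\Gamma$, and it is stationary if it is invariant under all translations. Its correlation functions $\rho^{(n)}:(\mathbb{R}^d)^n\to[0,\infty)$ are defined (when they exist) by $\mathbb{E}\bigl[\sum_{x_1\neq\dots\neq x_n\in\gamma}G(x_1,\dots,x_n)\bigr]=\int_{(\mathbb{R}^d)^n}G\,\rho^{(n)}\,\mathrm{d}x_1\cdots\mathrm{d}x_n$ for all measurable $G\ge 0$ (the sum being over $n$-tuples of pairwise distinct points of $\gamma$). For a stationary process $\rho=\rho^{(1)}$ is a constant (the density), $\rho_2(x)=\rho^{(2)}(x,0)$,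 and $\omega(x)=\rho_2(x)-\rho^2$ is the truncated pair correlation function. The Fourier transform is $\widehat f(\xi)=\int_{\mathbb{R}^d}e^{-2\pi\mathrm{i}\,x\cdot\xi}f(x)\,\mathrm{d}x$. If $\omega\in L^1(\mathbb{R}^d)$, the structure factor is $S(\xi)=\frac1\rho\bigl(\widehat\omega(\xi)+\rho\bigr)$. For the process $\mathsf{K}$ one has $\rho=K(0)=1$. It is known that the given determinantal correlation functions determine a unique stationary point process. *)

theory Defs
  imports "HOL-Analysis.Analysis" "HOL-Probability.Probability" "Jordan_Normal_Form.Determinant"
begin

text \<open>The Euclidean space \<open>\<real>\<^sup>d\<close>, \<open>d \<ge> 1\<close>, is an arbitrary type of class \<^class>\<open>euclidean_space\<close>.\<close>

definition locally_finite_sets :: "'a::euclidean_space set set" where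
  "locally_finite_sets = {\<gamma>. \<forall>B. bounded B \<longrightarrow> finite (\<gamma> \<inter> B)}"

definition configuration_space :: "'a::euclidean_space set measure" where
  "configuration_space = sigma locally_finite_sets
     {{\<gamma> \<in> locally_finite_sets. card (\<gamma> \<inter> D) = k} | D k. D \<in> sets borel \<and> bounded D}"

definition point_process :: "'a::euclidean_space set measure \<Rightarrow> bool" where
  "point_process P \<longleftrightarrow> prob_space P \<and> sets P = sets configuration_space"

definition stationary :: "'a::euclidean_space set measure \<Rightarrow> bool" where
  "stationary P \<longleftrightarrow> (\<forall>t. distr P P (\<lambda>\<gamma>. (\<lambda>x. x + t) ` \<gamma>) = P)"

text \<open>Points \<open>(x\<^sub>1, \<dots>, x\<^sub>n)\<close> of \<open>(\<real>\<^sup>d)\<^sup>n\<close> are functions on \<open>{..<n}\<close>, extended by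
  \<^const>\<open>undefined\<close> outside \<open>{..<n}\<close>; indices start at 0.\<close>

abbreviation tuple_measure :: "nat \<Rightarrow> (nat \<Rightarrow> 'a::euclidean_space) measure" where
  "tuple_measure n \<equiv> Pi\<^sub>M {..<n} (\<lambda>_. lborel)"

definition distinct_tuples :: "nat \<Rightarrow> 'a set \<Rightarrow> (nat \<Rightarrow> 'a) set" where
  "distinct_tuples n \<gamma> = {x \<in> {..<n} \<rightarrow>\<^sub>E \<gamma>. inj_on x {..<n}}"

definition is_correlation_function ::
    "'a::euclidean_space set measure \<Rightarrow> nat \<Rightarrow> ((nat \<Rightarrow> 'a) \<Rightarrow> real) \<Rightarrow> bool" where
  "is_correlation_function P n \<rho> \<longleftrightarrow>
     \<rho> \<in> borel_measurable (tuple_measure n) \<and>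
     (\<forall>x \<in> space (tuple_measure n). 0 \<le> \<rho> x) \<and>
     (\<forall>G :: (nat \<Rightarrow> 'a) \<Rightarrow> ennreal. G \<in> borel_measurable (tuple_measure n) \<longrightarrow>
        (\<integral>\<^sup>+\<gamma>. (\<integral>\<^sup>+x. G x \<partial>count_space (distinct_tuples n \<gamma>)) \<partial>P)
          = (\<integral>\<^sup>+x. G x * ennreal (\<rho> x) \<partial>tuple_measure n))"

text \<open>Correlation functions are determined by the process only up to null sets, whereas
  \<open>\<rho>\<^sub>2(x) = \<rho>\<^sup>(\<^sup>2\<^sup>)(x, 0)\<close> evaluates one on a null set of \<open>(\<real>\<^sup>d)\<^sup>2\<close>. For a stationary process
  one therefore takes a version that is invariant under all translations pointwise.
  This makes \<open>\<rho>\<^sup>(\<^sup>1\<^sup>)\<close> a constant and determines \<open>\<rho>\<^sub>2\<close> up to null sets of \<open>\<real>\<^sup>d\<close>, so that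
  its Fourier integrals do not depend on the choice.\<close>

definition correlation_function ::
    "'a::euclidean_space set measure \<Rightarrow> nat \<Rightarrow> (nat \<Rightarrow> 'a) \<Rightarrow> real" where
  "correlation_function P n = (SOME \<rho>. is_correlation_function P n \<rho> \<and>
     (\<forall>x \<in> space (tuple_measure n). \<forall>t. \<rho> (\<lambda>i\<in>{..<n}. x i + t) = \<rho> x))"

definition intensity :: "'a::euclidean_space set measure \<Rightarrow> real" where
  "intensity P = correlation_function P 1 (\<lambda>i\<in>{..<1}. 0)"

definition pair_correlation :: "'a::euclidean_space set measure \<Rightarrow> 'a \<Rightarrow> real" where
  "pair_correlation P x = correlation_function P 2 (\<lambda>i\<in>{..<2}. if i = 0 then x else 0)"

definition truncated_pair_correlation :: "'a::euclidean_space set measure \<Rightarrow> 'a \<Rightarrow> real" where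
  "truncated_pair_correlation P x = pair_correlation P x - (intensity P)\<^sup>2"

definition fourier_transform :: "('a::euclidean_space \<Rightarrow> complex) \<Rightarrow> 'a \<Rightarrow> complex" where
  "fourier_transform f \<xi> =
     (\<integral>x. exp (- 2 * of_real pi * \<i> * of_real (x \<bullet> \<xi>)) * f x \<partial>lebesgue)"

text \<open>Meaningful when the truncated pair correlation function is integrable.\<close>

definition structure_factor :: "'a::euclidean_space set measure \<Rightarrow> 'a \<Rightarrow> complex" where
  "structure_factor P \<xi> = 1 / of_real (intensity P) *
     (fourier_transform (\<lambda>x. of_real (truncated_pair_correlation P x)) \<xi> + of_real (intensity P))"

definition projection_kernel :: "'a::euclidean_space set \<Rightarrow> 'a \<Rightarrow> complex" where
  "projection_kernel E x = (LINT \<xi>:E|lebesgue. exp (2 * of_real pi * \<i> * of_real (x \<bullet> \<xi>)))"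

text \<open>The equation below includes that the determinants are real.\<close>

definition determinantal :: "'a::euclidean_space set measure \<Rightarrow> ('a \<Rightarrow> complex) \<Rightarrow> bool" where
  "determinantal P K \<longleftrightarrow> (\<forall>n\<ge>1. \<exists>\<rho>. is_correlation_function P n \<rho> \<and>
     (\<forall>x \<in> space (tuple_measure n).
        complex_of_real (\<rho> x) = Determinant.det (Matrix.mat n n (\<lambda>(i, j). K (x i - x j)))))"

end

(* With K(x) the Fourier integral of the indicator of E, the correlation functions are rho^(1) = 1 and
   rho^(2)(x, y) = 1 - |K(x - y)|^2, so omega = -|K|^2 almost everywhere. As |K|^2 is the Fourier
   integral of the autocorrelation h(u) = |(E + u) \<inter> E|, the formula for S is Fourier inversion for h.
   It holds at every point because h is continuous: inserting the Gaussian factor exp(-pi |eps x|^2)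
   turns the inverse transform of |K|^2 into an average of h around xi, which tends to h(xi). At xi = 0
   monotone convergence yields that |K|^2 is integrable, and dominated convergence then removes
   the factor for every xi. If S(xi) = 0, then |K|^2 (1 - cos(2 pi x . xi)) integrates to 0, so K = 0
   almost everywhere unless xi = 0, contradicting that |K|^2 integrates to 1. *)
theory Submission
  imports Defs
begin

no_notation Matrix.scalar_prod (infix \<open>\<bullet>\<close> 70)

section \<open>The Gaussian and its Fourier transform\<close>

lemma lborel_integral_affine:
  fixes f :: "'a::euclidean_space \<Rightarrow> 'b::{banach, second_countable_topology}"
  assumes [measurable]: "f \<in> borel_measurable borel" and "c \<noteq> 0"
  shows "(\<integral>x. f x \<partial>lborel) = \<bar>c\<bar> ^ DIM('a) *\<^sub>R (\<integral>x. f (t + c *\<^sub>R x) \<partial>lborel)"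
proof -
  have "(\<integral>x. f x \<partial>lborel) =
      (\<integral>x. f x \<partial>density (distr lborel borel (\<lambda>x. t + c *\<^sub>R x)) (\<lambda>_. \<bar>c\<bar> ^ DIM('a)))"
    using lborel_affine[OF \<open>c \<noteq> 0\<close>, of t] by simp
  also have "\<dots> = \<bar>c\<bar> ^ DIM('a) *\<^sub>R (\<integral>x. f (t + c *\<^sub>R x) \<partial>lborel)"
    by (simp add: integral_density integral_distr)
  finally show ?thesis .
qed

lemma lborel_integrable_affine:
  fixes f :: "'a::euclidean_space \<Rightarrow> 'b::{banach, second_countable_topology}"
  assumes "integrable lborel f" and "c \<noteq> 0"
  shows "integrable lborel (\<lambda>x. f (t + c *\<^sub>R x))"
proof -
  have [measurable]: "f \<in> borel_measurable borel"
    using borel_measurable_integrable[OF assms(1)] by simp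
  have "integrable (density (distr lborel borel (\<lambda>x. t + c *\<^sub>R x)) (\<lambda>_. \<bar>c\<bar> ^ DIM('a))) f"
    using assms(1) lborel_affine[OF \<open>c \<noteq> 0\<close>, of t] by simp
  then have "integrable lborel (\<lambda>x. \<bar>c\<bar> ^ DIM('a) *\<^sub>R f (t + c *\<^sub>R x))"
    by (simp add: integrable_density integrable_distr_eq)
  from integrable_scaleR_right[OF this, of "inverse (\<bar>c\<bar> ^ DIM('a))"] show ?thesis
    using \<open>c \<noteq> 0\<close> by simp
qed

text \<open>\<open>lborel\<close> is the image of the product of one-dimensional Lebesgue measures
  over \<open>Basis\<close>, so this is Fubini in coordinates. It reduces Gaussian integrals to
  dimension one.\<close>

lemma lborel_prod_Basis:
  fixes F :: "'a::euclidean_space \<Rightarrow> real \<Rightarrow> 'b::{real_normed_field, banach, second_countable_topology}"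
  assumes "\<And>b. b \<in> Basis \<Longrightarrow> integrable lborel (F b)"
  shows "integrable lborel (\<lambda>x. \<Prod>b\<in>Basis. F b (x \<bullet> b))" (is ?int)
    and "(\<integral>x. (\<Prod>b\<in>Basis. F b (x \<bullet> b)) \<partial>lborel) = (\<Prod>b\<in>Basis. \<integral>t. F b t \<partial>lborel)" (is ?eq)
proof -
  interpret product_sigma_finite "\<lambda>_::'a. lborel :: real measure" ..
  have [measurable]: "F b \<in> borel_measurable borel" if "b \<in> Basis" for b
    using borel_measurable_integrable[OF assms[OF that]] by simp
  have *: "(\<Prod>b\<in>Basis. F b ((\<Sum>b\<in>Basis. y b *\<^sub>R b) \<bullet> b)) = (\<Prod>b\<in>Basis. F b (y b))" for y
    by (intro prod.cong) simp_all
  show ?int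
    by (subst lborel_eq, subst integrable_distr_eq)
      (measurable, simp only: *, intro product_integrable_prod assms finite_Basis)
  show ?eq
    by (subst lborel_eq, subst integral_distr)
      (measurable, simp only: *, intro product_integral_prod assms finite_Basis)
qed

text \<open>With the factor \<open>pi\<close> in the exponent, the Gaussian is its own Fourier
  transform for the phase \<open>2 * pi * (x \<bullet> t)\<close> and has total mass 1. The type is
  left open so that the same constant serves on the whole space and on each coordinate axis.\<close>

definition gauss :: "'a::euclidean_space \<Rightarrow> real" where
  "gauss x = exp (- (pi * (norm x)\<^sup>2))"

lemma gauss_pos: "0 < gauss x"
  by (simp add: gauss_def)

lemma gauss_le_1: "gauss x \<le> 1"
  by (simp add: gauss_def)

lemma measurable_gauss [measurable]: "gauss \<in> borel_measurable borel"
  unfolding gauss_def by measurable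

lemma measurable_cis [measurable]: "cis \<in> borel_measurable borel"
  by (intro borel_measurable_continuous_onI continuous_intros)

lemma gauss_eq_prod: "gauss x = (\<Prod>b\<in>Basis. gauss (x \<bullet> b))"
proof -
  have "(norm x)\<^sup>2 = (\<Sum>b\<in>Basis. (x \<bullet> b)\<^sup>2)"
    unfolding power2_norm_eq_inner by (subst euclidean_inner) (simp add: power2_eq_square)
  then show ?thesis
    by (simp add: gauss_def sum_distrib_left sum_negf flip: exp_sum)
qed

text \<open>A rescaling turns the Gaussian into the standard normal density, whose characteristic
  function is known.\<close>

lemma fourier_gauss_real:
  "integrable lborel (\<lambda>x::real. gauss x)"
  "(\<integral>x. of_real (gauss x) * cis (2 * pi * (x * t)) \<partial>lborel) = complex_of_real (gauss t)"
proof -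
  \<comment> \<open>This one constant both rescales and normalises:
    \<open>pi * (c * x)\<^sup>2\<close> is \<open>x\<^sup>2 / 2\<close>, and \<open>c\<close> is the
    leading factor of the normal density.\<close>
  define c where "c = 1 / sqrt (2 * pi)"
  have c: "c > 0" "c\<^sup>2 = 1 / (2 * pi)" "2 * pi * c = sqrt (2 * pi)"
    by (simp_all add: c_def power_divide real_div_sqrt)
  have g: "std_normal_density x = c * gauss (c * x)" for x
    using c(2) by (simp add: std_normal_density_def gauss_def power_mult_distrib flip: c_def)
  \<comment> \<open>The moment of order 0 is the integral of the density itself.\<close>
  have "integrable lborel (\<lambda>x::real. gauss (0 + c * x))"
    using integrable_normal_moment[of 1 0 0] c(1) by (simp add: g)
  then show int: "integrable lborel (\<lambda>x::real. gauss x)"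
    using c(1) lborel_integrable_real_affine_iff[of c gauss 0] by simp
  have "(\<integral>x. of_real (gauss x) * cis (2 * pi * (x * t)) \<partial>lborel)
      = c *\<^sub>R (\<integral>x. of_real (gauss (c * x)) * cis (2 * pi * (c * x * t)) \<partial>lborel)"
    using c(1) by (subst lborel_integral_real_affine[where t=0 and c=c]) auto
  also have "\<dots> = (\<integral>x. std_normal_density x *\<^sub>R iexp (sqrt (2 * pi) * t * x) \<partial>lborel)"
  proof -
    have "c *\<^sub>R (of_real (gauss (c * x)) * cis (2 * pi * (c * x * t))) =
        std_normal_density x *\<^sub>R iexp (sqrt (2 * pi) * t * x)" for x
    proof -
      have "2 * pi * (c * x * t) = sqrt (2 * pi) * t * x"
        by (subst c(3)[symmetric]) simp
      then show ?thesis
        by (simp only:) (simp add: g cis_conv_exp scaleR_conv_of_real)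
    qed
    then show ?thesis
      by (simp flip: integral_scaleR_right)
  qed
  also have "\<dots> = char std_normal_distribution (sqrt (2 * pi) * t)"
    by (simp add: char_def integral_density)
  also have "\<dots> = gauss t"
    by (simp add: char_std_normal_distribution gauss_def power_mult_distrib)
  finally show "(\<integral>x. of_real (gauss x) * cis (2 * pi * (x * t)) \<partial>lborel) = complex_of_real (gauss t)" .
qed

lemma integrable_gauss: "integrable lborel (gauss :: 'a::euclidean_space \<Rightarrow> real)"
proof -
  have "(gauss :: 'a \<Rightarrow> real) = (\<lambda>x. \<Prod>b\<in>Basis. gauss (x \<bullet> b))"
    by (rule ext) (rule gauss_eq_prod)
  then show ?thesis
    by (rule ssubst) (intro lborel_prod_Basis fourier_gauss_real)
qed

lemma cis_sum: "cis (\<Sum>i\<in>I. f i) = (\<Prod>i\<in>I. cis (f i))"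
  by (induction I rule: infinite_finite_induct) (simp_all flip: cis_mult)

text \<open>Both the Gaussian and the character factor over the coordinates, which leaves a product
  of one-dimensional transforms.\<close>

lemma fourier_gauss:
  fixes t :: "'a::euclidean_space"
  shows "(\<integral>x. of_real (gauss x) * cis (2 * pi * (x \<bullet> t)) \<partial>lborel) = complex_of_real (gauss t)"
proof -
  have "of_real (gauss x) * cis (2 * pi * (x \<bullet> t)) =
      (\<Prod>b\<in>Basis. complex_of_real (gauss (x \<bullet> b)) * cis (2 * pi * ((x \<bullet> b) * (t \<bullet> b))))" for x
    by (subst gauss_eq_prod, subst euclidean_inner)
      (simp add: prod.distrib sum_distrib_left cis_sum)
  then have "(\<integral>x. of_real (gauss x) * cis (2 * pi * (x \<bullet> t)) \<partial>lborel) =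
      (\<integral>x. (\<Prod>b\<in>Basis. complex_of_real (gauss (x \<bullet> b)) * cis (2 * pi * ((x \<bullet> b) * (t \<bullet> b)))) \<partial>lborel)"
    by simp
  also have "\<dots> = (\<Prod>b\<in>Basis. \<integral>s. complex_of_real (gauss s) * cis (2 * pi * (s * (t \<bullet> b))) \<partial>lborel)"
  proof (rule lborel_prod_Basis)
    fix b
    show "integrable lborel (\<lambda>s. complex_of_real (gauss s) * cis (2 * pi * (s * (t \<bullet> b))))"
      by (rule Bochner_Integration.integrable_bound[OF fourier_gauss_real(1)])
        (auto simp: norm_mult)
  qed
  also have "\<dots> = gauss t"
    by (simp add: fourier_gauss_real gauss_eq_prod[of t])
  finally show ?thesis .
qed

section \<open>The autocorrelation of a set\<close>

text \<open>For Borel \<open>E\<close> this is |(E + u) \<inter> E|, since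
  \<open>indicator E (x - u)\<close> is the indicator of the translate E + u. The integral form
  suits Fubini and dominated convergence.\<close>

definition overlap :: "'a::euclidean_space set \<Rightarrow> 'a \<Rightarrow> real" where
  "overlap E u = (\<integral>x. indicator E x * indicator E (x - u) \<partial>lborel)"

section \<open>Translations and reflections, and continuity of translation in L^1\<close>

lemma lborel_integral_translate:
  fixes f :: "'a::euclidean_space \<Rightarrow> 'b::{banach, second_countable_topology}"
  assumes [measurable]: "f \<in> borel_measurable borel"
  shows "(\<integral>x. f (x - t) \<partial>lborel) = (\<integral>x. f x \<partial>lborel)"
  using lborel_integral_affine[OF assms, of 1 "- t"] by simp

lemma lborel_integrable_translate:
  fixes f :: "'a::euclidean_space \<Rightarrow> 'b::{banach, second_countable_topology}"
  assumes "integrable lborel f"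
  shows "integrable lborel (\<lambda>x. f (x - t))"
  using lborel_integrable_affine[OF assms, of 1 "- t"] by simp

lemma lborel_integral_reflect:
  fixes f :: "'a::euclidean_space \<Rightarrow> 'b::{banach, second_countable_topology}"
  assumes [measurable]: "f \<in> borel_measurable borel"
  shows "(\<integral>x. f (t - x) \<partial>lborel) = (\<integral>x. f x \<partial>lborel)"
  using lborel_integral_affine[OF assms, of "-1" "t"] by simp

lemma lborel_integrable_reflect:
  fixes f :: "'a::euclidean_space \<Rightarrow> 'b::{banach, second_countable_topology}"
  assumes "integrable lborel f"
  shows "integrable lborel (\<lambda>x. f (t - x))"
  using lborel_integrable_affine[OF assms, of "-1" "t"] by simp

text \<open>For indicators |a - b| = a + b - 2ab, so the L^1 distance is controlled by the integral
  of the product. That integrand vanishes off \<open>U\<close>, so the boundary of \<open>U\<close>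
  does not matter even if it has positive measure.\<close>

lemma continuous_translation_open:
  fixes U :: "'a::euclidean_space set"
  assumes "open U" and fin: "emeasure lborel U < \<infinity>" and "X \<longlonglongrightarrow> 0"
  shows "(\<lambda>n. \<integral>x. \<bar>indicator U (x - X n) - indicator U x :: real\<bar> \<partial>lborel) \<longlonglongrightarrow> 0"
proof -
  have [measurable]: "U \<in> sets borel"
    using \<open>open U\<close> by simp
  have int: "integrable lborel (indicator U :: 'a \<Rightarrow> real)"
    using fin by (intro integrable_real_indicator) simp_all
  have int': "integrable lborel (\<lambda>x. indicator U (x - t) :: real)" for t
    by (rule lborel_integrable_translate[OF int])
  have int'': "integrable lborel (\<lambda>x. indicator U x * indicator U (x - t) :: real)" for t
    by (rule Bochner_Integration.integrable_bound[OF int]) (auto simp: indicator_def)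
  have "(\<integral>x. \<bar>indicator U (x - t) - indicator U x :: real\<bar> \<partial>lborel) =
      (\<integral>x. indicator U (x - t) + indicator U x - 2 * (indicator U x * indicator U (x - t) :: real) \<partial>lborel)" for t
    by (intro Bochner_Integration.integral_cong) (auto simp: indicator_def)
  also have "\<dots> t = 2 * (\<integral>x. indicator U x \<partial>lborel) - 2 * (\<integral>x. indicator U x * indicator U (x - t) \<partial>lborel)" for t
    using int int' int'' lborel_integral_translate[of "indicator U :: 'a \<Rightarrow> real" t] by simp
  finally have eq: "(\<integral>x. \<bar>indicator U (x - t) - indicator U x :: real\<bar> \<partial>lborel) =
      2 * (\<integral>x. indicator U x \<partial>lborel) - 2 * (\<integral>x. indicator U x * indicator U (x - t) \<partial>lborel)" for t .
  have "(\<lambda>n. \<integral>x. indicator U x * indicator U (x - X n) \<partial>lborel) \<longlonglongrightarrow> (\<integral>x. (indicator U x :: real) \<partial>lborel)"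
  proof (rule integral_dominated_convergence)
    show "integrable lborel (indicator U :: 'a \<Rightarrow> real)"
      by (fact int)
    show "AE x in lborel. (\<lambda>n. indicator U x * indicator U (x - X n)) \<longlonglongrightarrow> (indicator U x :: real)"
    proof (rule AE_I2)
      fix x
      show "(\<lambda>n. indicator U x * indicator U (x - X n)) \<longlonglongrightarrow> (indicator U x :: real)"
      proof (cases "x \<in> U")
        case True
        have "(\<lambda>n. x - X n) \<longlonglongrightarrow> x - 0"
          using \<open>X \<longlonglongrightarrow> 0\<close> by (intro tendsto_intros)
        then have "\<forall>\<^sub>F n in sequentially. x - X n \<in> U"
          using True \<open>open U\<close> by (auto dest: topological_tendstoD)
        then have "\<forall>\<^sub>F n in sequentially. indicator U x * indicator U (x - X n) = (indicator U x :: real)"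
          by eventually_elim simp
        then show ?thesis
          by (rule tendsto_eventually)
      qed simp
    qed
  qed (auto simp: indicator_def)
  then have "(\<lambda>n. 2 * (\<integral>x. indicator U x \<partial>lborel) - 2 * (\<integral>x. indicator U x * indicator U (x - X n) \<partial>lborel))
      \<longlonglongrightarrow> 2 * (\<integral>x. indicator U x \<partial>lborel) - 2 * (\<integral>x. (indicator U x :: real) \<partial>lborel)"
    by (intro tendsto_intros)
  then show ?thesis
    by (simp add: eq)
qed

text \<open>For an open set the indicator of the translates converges pointwise on the set itself, so
  dominated convergence applies; a general set is approximated by open sets from outside.\<close>

lemma continuous_translation_indicator:
  fixes E :: "'a::euclidean_space set"
  assumes [measurable]: "E \<in> sets borel" and fin: "emeasure lborel E < \<infinity>" and "X \<longlonglongrightarrow> 0"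
  shows "(\<lambda>n. \<integral>x. \<bar>indicator E (x - X n) - indicator E x :: real\<bar> \<partial>lborel) \<longlonglongrightarrow> 0"
proof (rule LIMSEQ_I)
  fix r :: real assume "0 < r"
  have "E \<in> sets lebesgue"
    by simp
  moreover have "0 < r / 4"
    using \<open>0 < r\<close> by simp
  ultimately obtain U where U: "open U" "E \<subseteq> U" and "emeasure lebesgue (U - E) < ennreal (r / 4)"
    by (rule sets_lebesgue_outer_open)
  then have [measurable]: "U \<in> sets borel" and small: "emeasure lborel (U - E) < ennreal (r / 4)"
    by simp_all
  then have finD: "emeasure lborel (U - E) < \<infinity>"
    by (auto intro: less_trans)
  have "U = E \<union> (U - E)"
    using U(2) by auto
  then have "emeasure lborel U = emeasure lborel E + emeasure lborel (U - E)"
    by (metis Diff_disjoint plus_emeasure assms(1) \<open>U \<in> sets borel\<close> sets.Diff sets_lborel)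
  then have finU: "emeasure lborel U < \<infinity>"
    using fin finD by simp
  have intD: "integrable lborel (indicator (U - E) :: 'a \<Rightarrow> real)"
    using finD by (intro integrable_real_indicator) simp_all
  have intU: "integrable lborel (indicator U :: 'a \<Rightarrow> real)"
    using finU by (intro integrable_real_indicator) simp_all
  have intE: "integrable lborel (indicator E :: 'a \<Rightarrow> real)"
    using fin by (intro integrable_real_indicator) simp_all
  have "measure lborel (U - E) < r / 4"
    using small \<open>0 < r\<close> finD by (simp add: emeasure_eq_ennreal_measure ennreal_less_iff)
  then have smallD: "(\<integral>x. indicator (U - E) x \<partial>lborel) < r / 4"
    by simp
  \<comment> \<open>The indicator of \<open>E\<close> is that of \<open>U\<close> minus that of
    \<open>U - E\<close>. The triangle inequality therefore costs \<open>U - E\<close> and its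
    translate, each of measure below \<open>r / 4\<close>.\<close>
  have bound: "(\<integral>x. \<bar>indicator E (x - t) - indicator E x :: real\<bar> \<partial>lborel) \<le>
      r / 2 + (\<integral>x. \<bar>indicator U (x - t) - indicator U x :: real\<bar> \<partial>lborel)" for t
  proof -
    have "(\<integral>x. \<bar>indicator E (x - t) - indicator E x :: real\<bar> \<partial>lborel) \<le>
        (\<integral>x. (indicator (U - E) (x - t) + indicator (U - E) x) + \<bar>indicator U (x - t) - indicator U x :: real\<bar> \<partial>lborel)"
      using U(2) by (intro integral_mono Bochner_Integration.integrable_add integrable_abs
          Bochner_Integration.integrable_diff lborel_integrable_translate intD intU intE)
        (auto simp: indicator_def)
    also have "\<dots> = (\<integral>x. indicator (U - E) (x - t) \<partial>lborel) + (\<integral>x. indicator (U - E) x \<partial>lborel)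
        + (\<integral>x. \<bar>indicator U (x - t) - indicator U x :: real\<bar> \<partial>lborel)"
      by (simp only: Bochner_Integration.integral_add Bochner_Integration.integrable_add integrable_abs
          Bochner_Integration.integrable_diff lborel_integrable_translate intD intU intE)
    also have "(\<integral>x. indicator (U - E) (x - t) \<partial>lborel) = (\<integral>x. (indicator (U - E) x :: real) \<partial>lborel)"
      by (rule lborel_integral_translate) simp
    finally show ?thesis
      using smallD by linarith
  qed
  have "0 < r / 2"
    using \<open>0 < r\<close> by simp
  from LIMSEQ_D[OF continuous_translation_open[OF U(1) finU \<open>X \<longlonglongrightarrow> 0\<close>] this]
  obtain N where N: "\<And>n. n \<ge> N \<Longrightarrow>
      norm ((\<integral>x. \<bar>indicator U (x - X n) - indicator U x :: real\<bar> \<partial>lborel) - 0) < r / 2"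
    by blast
  show "\<exists>N. \<forall>n\<ge>N. norm ((\<integral>x. \<bar>indicator E (x - X n) - indicator E x :: real\<bar> \<partial>lborel) - 0) < r"
  proof (intro exI allI impI)
    fix n assume "N \<le> n"
    have "0 \<le> (\<integral>x. \<bar>indicator E (x - X n) - indicator E x :: real\<bar> \<partial>lborel)"
      by (intro integral_nonneg_AE AE_I2 abs_ge_zero)
    moreover have "(\<integral>x. \<bar>indicator U (x - X n) - indicator U x :: real\<bar> \<partial>lborel) < r / 2"
      using N[OF \<open>N \<le> n\<close>] by simp
    ultimately show "norm ((\<integral>x. \<bar>indicator E (x - X n) - indicator E x :: real\<bar> \<partial>lborel) - 0) < r"
      using bound[of "X n"] by simp
  qed
qed

section \<open>Bounds and continuity of the autocorrelation\<close>

context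
  fixes E :: "'a::euclidean_space set"
  assumes E [measurable]: "E \<in> sets borel" and fin: "emeasure lborel E < \<infinity>"
begin

lemma integrable_indicator_E: "integrable lborel (indicator E :: 'a \<Rightarrow> real)"
  using fin by (intro integrable_real_indicator) simp_all

lemma integrable_overlap_integrand:
  "integrable lborel (\<lambda>x. indicator E x * indicator E (x - u) :: real)"
  by (rule Bochner_Integration.integrable_bound[OF integrable_indicator_E]) (auto simp: indicator_def)

lemma overlap_nonneg: "0 \<le> overlap E u"
  unfolding overlap_def by (intro integral_nonneg_AE AE_I2) simp

lemma overlap_le: "overlap E u \<le> measure lborel E"
proof -
  have "overlap E u \<le> (\<integral>x. indicator E x \<partial>lborel)"
    unfolding overlap_def
    by (intro integral_mono integrable_overlap_integrand integrable_indicator_E) (auto simp: indicator_def)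
  then show ?thesis
    by simp
qed

lemma overlap_0: "overlap E 0 = measure lborel E"
proof -
  have "overlap E 0 = (\<integral>x. indicator E x \<partial>lborel)"
    unfolding overlap_def by (intro Bochner_Integration.integral_cong) (auto simp: indicator_def)
  then show ?thesis
    by simp
qed

text \<open>The difference of two overlaps is at most the L^1 distance between two translates of the
  indicator. Shifting the variable by \<open>u\<close> reduces this to continuity of translation at
  0.\<close>

lemma tendsto_overlap:
  assumes "X \<longlonglongrightarrow> u"
  shows "(\<lambda>n. overlap E (X n)) \<longlonglongrightarrow> overlap E u"
proof (rule LIM_zero_cancel, rule Lim_null_comparison)
  have intd: "integrable lborel (\<lambda>x. \<bar>indicator E (x - t) - indicator E (x - s) :: real\<bar>)" for s t
    by (intro integrable_abs Bochner_Integration.integrable_diff lborel_integrable_translate integrable_indicator_E)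
  have "norm (overlap E t - overlap E u) \<le>
      (\<integral>x. \<bar>indicator E (x - (t - u)) - indicator E x :: real\<bar> \<partial>lborel)" for t
  proof -
    have "norm (overlap E t - overlap E u) =
        norm (\<integral>x. indicator E x * indicator E (x - t) - (indicator E x * indicator E (x - u) :: real) \<partial>lborel)"
      unfolding overlap_def by (subst Bochner_Integration.integral_diff) (simp_all add: integrable_overlap_integrand)
    also have "\<dots> \<le> (\<integral>x. \<bar>indicator E (x - t) - indicator E (x - u) :: real\<bar> \<partial>lborel)"
      by (rule order_trans[OF integral_norm_bound], intro integral_mono integrable_norm
          Bochner_Integration.integrable_diff integrable_overlap_integrand intd) (auto simp: indicator_def)
    also have "\<dots> = (\<integral>x. \<bar>indicator E ((x - u) - (t - u)) - indicator E (x - u) :: real\<bar> \<partial>lborel)"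
      by simp
    also have "\<dots> = (\<integral>x. \<bar>indicator E (x - (t - u)) - indicator E x :: real\<bar> \<partial>lborel)"
      by (rule lborel_integral_translate[of "\<lambda>x. \<bar>indicator E (x - (t - u)) - indicator E x\<bar>"]) simp
    finally show ?thesis .
  qed
  then show "\<forall>\<^sub>F n in sequentially. norm (overlap E (X n) - overlap E u) \<le>
      (\<integral>x. \<bar>indicator E (x - (X n - u)) - indicator E x :: real\<bar> \<partial>lborel)"
    by simp
  show "(\<lambda>n. \<integral>x. \<bar>indicator E (x - (X n - u)) - indicator E x :: real\<bar> \<partial>lborel) \<longlonglongrightarrow> 0"
    using assms by (intro continuous_translation_indicator E fin) (simp add: LIM_zero)
qed

lemma measurable_overlap [measurable]: "overlap E \<in> borel_measurable borel"
proof (rule borel_measurable_continuous_onI)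
  show "continuous_on UNIV (overlap E)"
    by (auto simp: continuous_on_sequentially comp_def intro: tendsto_overlap)
qed

end

section \<open>Fourier inversion for the autocorrelation\<close>

text \<open>The projection kernel of a Borel set, written over \<open>lborel\<close> so that Fubini
  on \<open>lborel_pair\<close> is available.\<close>

definition fourier_indicator :: "'a::euclidean_space set \<Rightarrow> 'a \<Rightarrow> complex" where
  "fourier_indicator E x = (\<integral>\<eta>. of_real (indicator E \<eta>) * cis (2 * pi * (x \<bullet> \<eta>)) \<partial>lborel)"

context
  fixes E :: "'a::euclidean_space set"
  assumes E [measurable]: "E \<in> sets borel" and fin: "emeasure lborel E < \<infinity>"
begin

lemma measurable_fourier_indicator [measurable]: "fourier_indicator E \<in> borel_measurable borel"
  unfolding fourier_indicator_def[abs_def] by measurable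

text \<open>Writing |K|^2 as K times its conjugate gives a double integral over E \<times> E, and
  the difference of the two variables becomes the variable of the autocorrelation. Both claims are
  Fubini for the same integrand.\<close>

lemma integrable_overlap: "integrable lborel (overlap E)" (is ?int)
  and norm_fourier_indicator_eq: "complex_of_real ((norm (fourier_indicator E x))\<^sup>2) =
    (\<integral>u. of_real (overlap E u) * cis (2 * pi * (x \<bullet> u)) \<partial>lborel)" (is ?eq)
proof -
  note intE = integrable_indicator_E[OF E fin]
  \<comment> \<open>This is the integrand of K(x) times its conjugate when the second point of
    \<open>E\<close> is written as \<open>\<eta> - u\<close>. Its norm is free of \<open>x\<close>;
    integrating out \<open>\<eta>\<close> leaves the overlap, while the norm integrated over
    \<open>u\<close> gives |E| for each \<open>\<eta>\<close> in \<open>E\<close>.\<close>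
  define f where "f x \<eta> u = of_real (indicator E \<eta> * indicator E (\<eta> - u)) * cis (2 * pi * (x \<bullet> u))"
    for x \<eta> u :: 'a
  have [measurable]: "case_prod (f x) \<in> borel_measurable (lborel \<Otimes>\<^sub>M lborel)" for x
    unfolding f_def by measurable
  have norm_f: "norm (f x \<eta> u) = indicator E \<eta> * indicator E (\<eta> - u)" for x \<eta> u
    by (simp add: f_def norm_mult)
  have int_f: "integrable (lborel \<Otimes>\<^sub>M lborel) (case_prod (f x))" for x
  proof (rule lborel_pair.Fubini_integrable)
    have "(\<integral>u. norm (case_prod (f x) (\<eta>, u)) \<partial>lborel) = indicator E \<eta> * measure lborel E" for \<eta>
      using lborel_integral_reflect[of "indicator E :: 'a \<Rightarrow> real" \<eta>] by (simp add: norm_f)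
    then show "integrable lborel (\<lambda>\<eta>. \<integral>u. norm (case_prod (f x) (\<eta>, u)) \<partial>lborel)"
      using intE by (simp only:) simp
    show "AE \<eta> in lborel. integrable lborel (\<lambda>u. case_prod (f x) (\<eta>, u))"
    proof (rule AE_I2)
      fix \<eta>
      show "integrable lborel (\<lambda>u. case_prod (f x) (\<eta>, u))"
        by (rule Bochner_Integration.integrable_bound[OF lborel_integrable_reflect[OF intE, of \<eta>]])
          (auto simp: norm_f f_def indicator_def)
    qed
  qed measurable
  have snd: "(\<integral>\<eta>. f x \<eta> u \<partial>lborel) = of_real (overlap E u) * cis (2 * pi * (x \<bullet> u))" for x u
    by (simp add: f_def overlap_def flip: integral_complex_of_real)
  \<comment> \<open>At \<open>x = 0\<close> the character is 1, so the partial integral is the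
    overlap itself.\<close>
  have "integrable lborel (\<lambda>u. \<integral>\<eta>. f 0 \<eta> u \<partial>lborel)"
    using int_f by (rule lborel_pair.integrable_snd)
  then have "integrable lborel (\<lambda>u. complex_of_real (overlap E u))"
    by (simp add: snd)
  from integrable_Re[OF this] show ?int
    by simp
  \<comment> \<open>The conjugate factor is reflected about an arbitrary \<open>\<eta>\<close>,
    later the integration variable of the other factor; the two phases then combine to one in
    \<open>u\<close> alone.\<close>
  have cnj: "cnj (fourier_indicator E x) =
      (\<integral>u. of_real (indicator E (\<eta> - u)) * cis (- 2 * pi * (x \<bullet> (\<eta> - u))) \<partial>lborel)" for \<eta>
  proof -
    have "cnj (fourier_indicator E x) =
        (\<integral>\<eta>. of_real (indicator E \<eta>) * cis (- 2 * pi * (x \<bullet> \<eta>)) \<partial>lborel)"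
      unfolding fourier_indicator_def
      by (subst Bochner_Integration.integral_cnj[symmetric])
        (simp add: cis_cnj del: Bochner_Integration.integral_cnj)
    also have "\<dots> = (\<integral>u. of_real (indicator E (\<eta> - u)) * cis (- 2 * pi * (x \<bullet> (\<eta> - u))) \<partial>lborel)"
      by (rule lborel_integral_reflect[symmetric]) measurable
    finally show ?thesis .
  qed
  have "complex_of_real ((norm (fourier_indicator E x))\<^sup>2) =
      (\<integral>\<eta>. (of_real (indicator E \<eta>) * cis (2 * pi * (x \<bullet> \<eta>))) * cnj (fourier_indicator E x) \<partial>lborel)"
    unfolding complex_norm_square by (simp add: fourier_indicator_def)
  also have "\<dots> = (\<integral>\<eta>. (\<integral>u. f x \<eta> u \<partial>lborel) \<partial>lborel)"
  proof (rule Bochner_Integration.integral_cong[OF refl])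
    fix \<eta>
    have "cis (2 * pi * (x \<bullet> \<eta>)) * cis (- 2 * pi * (x \<bullet> (\<eta> - u))) = cis (2 * pi * (x \<bullet> u))" for u
      by (simp add: cis_mult inner_diff_right algebra_simps)
    then have "f x \<eta> u = (of_real (indicator E \<eta>) * cis (2 * pi * (x \<bullet> \<eta>))) *
        (of_real (indicator E (\<eta> - u)) * cis (- 2 * pi * (x \<bullet> (\<eta> - u))))" for u
      unfolding f_def by (metis (no_types, opaque_lifting) mult.assoc mult.left_commute of_real_mult)
    then show "(of_real (indicator E \<eta>) * cis (2 * pi * (x \<bullet> \<eta>))) * cnj (fourier_indicator E x) =
        (\<integral>u. f x \<eta> u \<partial>lborel)"
      by (simp only: cnj[of \<eta>] integral_mult_right_zero)
  qed
  also have "\<dots> = (\<integral>u. (\<integral>\<eta>. f x \<eta> u \<partial>lborel) \<partial>lborel)"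
    using int_f by (rule lborel_pair.Fubini_integral[symmetric])
  finally show ?eq
    by (simp add: snd)
qed

text \<open>The Gaussian factor makes the double integral in \<open>x\<close> and \<open>u\<close>
  absolutely convergent. Integrating first in \<open>x\<close> gives a rescaled Gaussian centred at
  \<open>\<xi>\<close>, and substituting \<open>u = \<xi> + \<epsilon> v\<close> absorbs the
  scaling.\<close>

lemma gauss_regularisation:
  assumes "0 < \<epsilon>"
  shows "(\<integral>x. of_real ((norm (fourier_indicator E x))\<^sup>2 * gauss (\<epsilon> *\<^sub>R x)) * cis (- 2 * pi * (x \<bullet> \<xi>)) \<partial>lborel) =
    complex_of_real (\<integral>v. overlap E (\<xi> + \<epsilon> *\<^sub>R v) * gauss v \<partial>lborel)"
proof -
  note [measurable] = measurable_overlap[OF E fin]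
  \<comment> \<open>The Jacobian of scaling by \<open>\<epsilon>\<close>. It enters through the
    substitution in \<open>u\<close> and cancels against its inverse from the scaled Gaussian in
    \<open>x\<close>.\<close>
  define d where "d = \<epsilon> ^ DIM('a)"
  have d: "d > 0"
    using assms by (simp add: d_def)
  have int_gauss: "integrable lborel (\<lambda>x::'a. gauss (\<epsilon> *\<^sub>R x))"
    using lborel_integrable_affine[OF integrable_gauss, of \<epsilon> 0] assms by simp
  define f where "f x u = of_real (gauss (\<epsilon> *\<^sub>R x) * overlap E u) * cis (2 * pi * (x \<bullet> (u - \<xi>)))"
    for x u :: 'a
  have [measurable]: "case_prod f \<in> borel_measurable (lborel \<Otimes>\<^sub>M lborel)"
    unfolding f_def by measurable
  have norm_f: "norm (f x u) = gauss (\<epsilon> *\<^sub>R x) * overlap E u" for x u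
    using gauss_pos[of "\<epsilon> *\<^sub>R x"] overlap_nonneg[OF E fin, of u] by (simp add: f_def norm_mult)
  have int_f: "integrable (lborel \<Otimes>\<^sub>M lborel) (case_prod f)"
  proof (rule lborel_pair.Fubini_integrable)
    show "integrable lborel (\<lambda>x. \<integral>u. norm (case_prod f (x, u)) \<partial>lborel)"
      using int_gauss by (simp add: norm_f)
    show "AE x in lborel. integrable lborel (\<lambda>u. case_prod f (x, u))"
    proof (rule AE_I2)
      fix x
      have "integrable lborel (\<lambda>u. norm (f x u))"
        unfolding norm_f using integrable_overlap by simp
      then show "integrable lborel (\<lambda>u. case_prod f (x, u))"
        by (subst (asm) integrable_norm_iff) (simp_all add: measurable_Pair2)
    qed
  qed measurable
  have "of_real ((norm (fourier_indicator E x))\<^sup>2 * gauss (\<epsilon> *\<^sub>R x)) * cis (- 2 * pi * (x \<bullet> \<xi>)) =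
      (\<integral>u. f x u \<partial>lborel)" for x
  proof -
    have "cis (2 * pi * (x \<bullet> (u - \<xi>))) = cis (2 * pi * (x \<bullet> u)) * cis (- 2 * pi * (x \<bullet> \<xi>))" for u
      by (simp add: cis_mult inner_diff_right algebra_simps)
    then have f: "f x u = (of_real (overlap E u) * cis (2 * pi * (x \<bullet> u))) *
        (of_real (gauss (\<epsilon> *\<^sub>R x)) * cis (- 2 * pi * (x \<bullet> \<xi>)))" for u
      by (simp add: f_def)
    show ?thesis
      unfolding of_real_mult norm_fourier_indicator_eq f by (simp only: integral_mult_left_zero) (simp only: mult.assoc)
  qed
  then have "(\<integral>x. of_real ((norm (fourier_indicator E x))\<^sup>2 * gauss (\<epsilon> *\<^sub>R x)) * cis (- 2 * pi * (x \<bullet> \<xi>)) \<partial>lborel) =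
      (\<integral>x. (\<integral>u. f x u \<partial>lborel) \<partial>lborel)"
    by simp
  also have "\<dots> = (\<integral>u. (\<integral>x. f x u \<partial>lborel) \<partial>lborel)"
    using int_f by (rule lborel_pair.Fubini_integral[symmetric])
  also have "\<dots> = d *\<^sub>R (\<integral>v. (\<integral>x. f x (\<xi> + \<epsilon> *\<^sub>R v) \<partial>lborel) \<partial>lborel)"
    using assms by (subst lborel_integral_affine[of _ \<epsilon> \<xi>]) (simp_all add: d_def)
  also have "\<dots> = (\<integral>v. d *\<^sub>R (\<integral>x. f x (\<xi> + \<epsilon> *\<^sub>R v) \<partial>lborel) \<partial>lborel)"
    by simp
  also have "\<dots> = (\<integral>v. complex_of_real (overlap E (\<xi> + \<epsilon> *\<^sub>R v) * gauss v) \<partial>lborel)"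
  proof (rule Bochner_Integration.integral_cong[OF refl])
    fix v :: 'a
    have "complex_of_real (gauss v) = (\<integral>x. of_real (gauss x) * cis (2 * pi * (x \<bullet> v)) \<partial>lborel)"
      by (simp add: fourier_gauss)
    also have "\<dots> = d *\<^sub>R (\<integral>x. of_real (gauss (\<epsilon> *\<^sub>R x)) * cis (2 * pi * (\<epsilon> *\<^sub>R x \<bullet> v)) \<partial>lborel)"
      using assms by (subst lborel_integral_affine[of _ \<epsilon> 0]) (simp_all add: d_def)
    finally have gv: "complex_of_real (gauss v) = d *\<^sub>R (\<integral>x. of_real (gauss (\<epsilon> *\<^sub>R x)) * cis (2 * pi * (\<epsilon> *\<^sub>R x \<bullet> v)) \<partial>lborel)" .
    have "f x (\<xi> + \<epsilon> *\<^sub>R v) = of_real (overlap E (\<xi> + \<epsilon> *\<^sub>R v)) *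
        (of_real (gauss (\<epsilon> *\<^sub>R x)) * cis (2 * pi * (\<epsilon> *\<^sub>R x \<bullet> v)))" for x
      by (simp add: f_def)
    then show "d *\<^sub>R (\<integral>x. f x (\<xi> + \<epsilon> *\<^sub>R v) \<partial>lborel) =
        complex_of_real (overlap E (\<xi> + \<epsilon> *\<^sub>R v) * gauss v)"
      unfolding of_real_mult gv by (simp add: scaleR_conv_of_real)
  qed
  finally show ?thesis
    by (simp only: integral_complex_of_real)
qed

text \<open>Rescaled Gaussians form an approximate identity: \<open>overlap E\<close> is continuous
  and bounded by |E|, so dominated convergence applies.\<close>

lemma tendsto_gauss_average:
  assumes "X \<longlonglongrightarrow> 0"
  shows "(\<lambda>n. \<integral>v. overlap E (\<xi> + X n *\<^sub>R v) * gauss v \<partial>lborel) \<longlonglongrightarrow> overlap E \<xi>"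
proof -
  note [measurable] = measurable_overlap[OF E fin]
  \<comment> \<open>The total mass is the Fourier transform of the Gaussian at 0, which is
    \<open>gauss 0\<close>.\<close>
  have "(\<integral>x. gauss (x::'a) \<partial>lborel) = 1"
  proof -
    have "complex_of_real (\<integral>x. gauss (x::'a) \<partial>lborel) = of_real (gauss (0::'a))"
      unfolding fourier_gauss[of "0::'a", symmetric] by (simp flip: integral_complex_of_real)
    then show ?thesis
      by (simp add: gauss_def)
  qed
  then have eq: "overlap E \<xi> = (\<integral>v. overlap E \<xi> * gauss (v::'a) \<partial>lborel)"
    by simp
  show ?thesis
  proof (subst eq, rule integral_dominated_convergence)
    show "integrable lborel (\<lambda>v::'a. measure lborel E * gauss v)"
      by (intro integrable_mult_right integrable_gauss)
    show "AE v in lborel. (\<lambda>n. overlap E (\<xi> + X n *\<^sub>R v) * gauss v) \<longlonglongrightarrow> overlap E \<xi> * gauss v"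
    proof (intro AE_I2 tendsto_mult tendsto_const tendsto_overlap[OF E fin])
      fix v
      have "(\<lambda>n. \<xi> + X n *\<^sub>R v) \<longlonglongrightarrow> \<xi> + 0 *\<^sub>R v"
        using assms by (intro tendsto_intros)
      then show "(\<lambda>n. \<xi> + X n *\<^sub>R v) \<longlonglongrightarrow> \<xi>"
        by simp
    qed
    show "AE v in lborel. norm (overlap E (\<xi> + X n *\<^sub>R v) * gauss v) \<le> measure lborel E * gauss v" for n
      by (intro AE_I2)
        (simp add: overlap_nonneg[OF E fin] overlap_le[OF E fin] gauss_pos less_imp_le mult_right_mono)
  qed measurable
qed

text \<open>Boundedness makes |K|^2 times a Gaussian integrable.\<close>

lemma norm_fourier_indicator_le: "norm (fourier_indicator E x) \<le> measure lborel E"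
proof -
  have "norm (fourier_indicator E x) \<le>
      (\<integral>\<eta>. norm (complex_of_real (indicator E \<eta>) * cis (2 * pi * (x \<bullet> \<eta>))) \<partial>lborel)"
    unfolding fourier_indicator_def by (rule integral_norm_bound)
  then show ?thesis
    by (simp add: norm_mult)
qed

text \<open>Integrability of the transform |K|^2 comes from its sign: at \<open>\<xi> = 0\<close>
  the regularised integrals have nonnegative integrands and converge to
  \<open>overlap E 0\<close>.\<close>

lemma integrable_norm_fourier_indicator: "integrable lborel (\<lambda>x. (norm (fourier_indicator E x))\<^sup>2)" (is ?int)
  and fourier_inversion: "(\<integral>x. of_real ((norm (fourier_indicator E x))\<^sup>2) * cis (- 2 * pi * (x \<bullet> \<xi>)) \<partial>lborel) =
    complex_of_real (overlap E \<xi>)" (is ?inv)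
proof -
  \<comment> \<open>The scales decrease to 0 but stay positive, so the damped functions
    \<open>F n\<close> below increase to |K|^2.\<close>
  define \<epsilon> :: "nat \<Rightarrow> real" where "\<epsilon> n = inverse (real (Suc n))" for n
  have \<epsilon>_pos: "0 < \<epsilon> n" for n
    by (simp add: \<epsilon>_def)
  have \<epsilon>_lim: "\<epsilon> \<longlonglongrightarrow> 0"
    unfolding \<epsilon>_def by (rule LIMSEQ_inverse_real_of_nat)
  have \<epsilon>_mono: "\<epsilon> n \<le> \<epsilon> m" if "m \<le> n" for m n
    using that by (simp add: \<epsilon>_def)
  define F where "F n x = (norm (fourier_indicator E x))\<^sup>2 * gauss (\<epsilon> n *\<^sub>R x)" for n x
  have [measurable]: "F n \<in> borel_measurable borel" for n
    unfolding F_def by measurable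
  have F_nonneg: "0 \<le> F n x" and F_le: "F n x \<le> (norm (fourier_indicator E x))\<^sup>2" for n x
    using gauss_pos[of "\<epsilon> n *\<^sub>R x"] gauss_le_1[of "\<epsilon> n *\<^sub>R x"]
    by (auto simp: F_def mult_left_le)
  have F_lim: "(\<lambda>n. F n x) \<longlonglongrightarrow> (norm (fourier_indicator E x))\<^sup>2" for x
  proof -
    have "(\<lambda>n. F n x) \<longlonglongrightarrow> (norm (fourier_indicator E x))\<^sup>2 * exp (- (pi * (norm (0 *\<^sub>R x))\<^sup>2))"
      unfolding F_def gauss_def by (intro tendsto_intros \<epsilon>_lim)
    then show ?thesis
      by simp
  qed
  have reg: "(\<integral>x. of_real (F n x) * cis (- 2 * pi * (x \<bullet> \<xi>)) \<partial>lborel) =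
      complex_of_real (\<integral>v. overlap E (\<xi> + \<epsilon> n *\<^sub>R v) * gauss v \<partial>lborel)" for n \<xi>
    unfolding F_def by (rule gauss_regularisation[OF \<epsilon>_pos])
  show int: ?int
  proof (rule integrable_monotone_convergence)
    show "integrable lborel (F n)" for n
    proof (rule Bochner_Integration.integrable_bound)
      show "integrable lborel (\<lambda>x::'a. (measure lborel E)\<^sup>2 * gauss (0 + \<epsilon> n *\<^sub>R x))"
        using \<epsilon>_pos[of n] by (intro integrable_mult_right lborel_integrable_affine integrable_gauss) simp
      show "AE x in lborel. norm (F n x) \<le> norm ((measure lborel E)\<^sup>2 * gauss (0 + \<epsilon> n *\<^sub>R x))"
        by (intro AE_I2) (simp add: F_def gauss_pos less_imp_le mult_right_mono power_mono
            norm_fourier_indicator_le abs_mult)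
    qed simp
    show "AE x in lborel. mono (\<lambda>n. F n x)"
    proof (intro AE_I2 monoI)
      fix x :: 'a and m n :: nat assume "m \<le> n"
      then have "(norm (\<epsilon> n *\<^sub>R x))\<^sup>2 \<le> (norm (\<epsilon> m *\<^sub>R x))\<^sup>2"
        using \<epsilon>_pos[of n] \<epsilon>_pos[of m] \<epsilon>_mono[of m n] by (intro power_mono) (auto intro: mult_right_mono)
      then show "F m x \<le> F n x"
        by (auto simp: F_def gauss_def intro!: mult_left_mono)
    qed
    show "AE x in lborel. (\<lambda>n. F n x) \<longlonglongrightarrow> (norm (fourier_indicator E x))\<^sup>2"
      by (intro AE_I2 F_lim)
    have "complex_of_real (\<integral>x. F n x \<partial>lborel) =
        complex_of_real (\<integral>v. overlap E (0 + \<epsilon> n *\<^sub>R v) * gauss v \<partial>lborel)" for n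
      using reg[of n 0] by simp
    then have "(\<integral>x. F n x \<partial>lborel) = (\<integral>v. overlap E (0 + \<epsilon> n *\<^sub>R v) * gauss v \<partial>lborel)" for n
      by (simp only: of_real_eq_iff)
    then show "(\<lambda>n. \<integral>x. F n x \<partial>lborel) \<longlonglongrightarrow> overlap E 0"
      by (simp only: tendsto_gauss_average[OF \<epsilon>_lim])
  qed measurable
  have "(\<lambda>n. \<integral>x. of_real (F n x) * cis (- 2 * pi * (x \<bullet> \<xi>)) \<partial>lborel) \<longlonglongrightarrow>
      (\<integral>x. of_real ((norm (fourier_indicator E x))\<^sup>2) * cis (- 2 * pi * (x \<bullet> \<xi>)) \<partial>lborel)"
  proof (rule integral_dominated_convergence)
    show "AE x in lborel. (\<lambda>n. of_real (F n x) * cis (- 2 * pi * (x \<bullet> \<xi>))) \<longlonglongrightarrow>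
        of_real ((norm (fourier_indicator E x))\<^sup>2) * cis (- 2 * pi * (x \<bullet> \<xi>))"
      by (intro AE_I2 tendsto_intros F_lim)
    show "AE x in lborel. norm (complex_of_real (F n x) * cis (- 2 * pi * (x \<bullet> \<xi>))) \<le>
        (norm (fourier_indicator E x))\<^sup>2" for n
      by (intro AE_I2) (simp add: norm_mult F_nonneg F_le)
    show "integrable lborel (\<lambda>x. (norm (fourier_indicator E x))\<^sup>2)"
      by (fact int)
  qed measurable
  moreover have "(\<lambda>n. \<integral>x. of_real (F n x) * cis (- 2 * pi * (x \<bullet> \<xi>)) \<partial>lborel) \<longlonglongrightarrow>
      complex_of_real (overlap E \<xi>)"
    unfolding reg by (intro tendsto_of_real tendsto_gauss_average \<epsilon>_lim)
  ultimately show ?inv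
    by (rule LIMSEQ_unique)
qed

text \<open>Equality would force \<open>\<bar>K x\<bar>\<^sup>2 (1 - cos (2 \<pi> (x \<bullet> \<xi>)))\<close> to vanish almost everywhere, whereas its
  second factor vanishes only on the null set of \<open>x\<close> with \<open>x \<bullet> \<xi> \<in> \<int>\<close>.\<close>

lemma overlap_less:
  assumes "\<xi> \<noteq> 0" and pos: "0 < measure lborel E"
  shows "overlap E \<xi> < measure lborel E"
proof (rule ccontr)
  assume "\<not> overlap E \<xi> < measure lborel E"
  then have eq: "overlap E \<xi> = measure lborel E"
    using overlap_le[OF E fin, of \<xi>] by simp
  define w where "w x = (norm (fourier_indicator E x))\<^sup>2" for x
  have w: "integrable lborel w" "w \<in> borel_measurable borel"
    unfolding w_def by (rule integrable_norm_fourier_indicator) measurable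
  note [measurable] = w(2)
  have int_cis: "integrable lborel (\<lambda>x. complex_of_real (w x) * cis (- 2 * pi * (x \<bullet> t)))" for t
    by (rule Bochner_Integration.integrable_bound[OF w(1)]) (auto simp: norm_mult)
  \<comment> \<open>Real parts of the inversion formula: \<open>overlap E\<close> is the cosine
    transform of \<open>w\<close>.\<close>
  have int_cos: "integrable lborel (\<lambda>x. w x * cos (2 * pi * (x \<bullet> t)))"
    and lint_cos: "(\<integral>x. w x * cos (2 * pi * (x \<bullet> t)) \<partial>lborel) = overlap E t" for t
    using integrable_Re[OF int_cis[of t]] integral_Re[OF int_cis[of t]] fourier_inversion[of t]
    by (simp_all add: w_def)
  have nonneg: "0 \<le> w x * (1 - cos (2 * pi * (x \<bullet> \<xi>)))" for x
    by (simp add: w_def)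
  have "(\<integral>x. w x * (1 - cos (2 * pi * (x \<bullet> \<xi>))) \<partial>lborel) = 0"
    using lint_cos[of 0] lint_cos[of \<xi>] w(1) int_cos eq overlap_0[OF E fin]
    by (simp add: right_diff_distrib)
  moreover have "integrable lborel (\<lambda>x. w x * (1 - cos (2 * pi * (x \<bullet> \<xi>))))"
    using w(1) int_cos by (simp add: right_diff_distrib)
  ultimately have "AE x in lborel. w x * (1 - cos (2 * pi * (x \<bullet> \<xi>))) = 0"
    using nonneg by (subst (asm) integral_nonneg_eq_0_iff_AE) auto
  moreover have "AE x in lborel. \<forall>k::int. x \<bullet> \<xi> \<noteq> of_int k"
  proof (subst AE_all_countable, rule allI)
    fix k :: int
    have "negligible {x. \<xi> \<bullet> x = of_int k}"
      using \<open>\<xi> \<noteq> 0\<close> by (intro negligible_hyperplane) simp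
    then have "{x. \<xi> \<bullet> x = of_int k} \<in> null_sets lebesgue"
      by (simp add: negligible_iff_null_sets)
    then have "AE x in lebesgue. x \<notin> {x. \<xi> \<bullet> x = of_int k}"
      by (rule AE_not_in)
    then show "AE x in lborel. x \<bullet> \<xi> \<noteq> of_int k"
      by (simp add: AE_completion_iff inner_commute)
  qed
  ultimately have "AE x in lborel. w x = 0"
  proof eventually_elim
    fix x assume *: "w x * (1 - cos (2 * pi * (x \<bullet> \<xi>))) = 0" "\<forall>k::int. x \<bullet> \<xi> \<noteq> of_int k"
    have "cos (2 * pi * (x \<bullet> \<xi>)) \<noteq> 1"
      using *(2) by (auto simp: cos_one_2pi_int)
    with *(1) show "w x = 0"
      by simp
  qed
  then have "(\<integral>x. w x \<partial>lborel) = 0"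
    by (rule integral_eq_zero_AE)
  \<comment> \<open>By inversion at 0 the integral of \<open>w\<close> is also |E|, which is
    positive.\<close>
  then show False
    using lint_cos[of 0] overlap_0[OF E fin] pos by simp
qed

end

section \<open>Correlation functions of translation-invariant form\<close>

lemma emeasure_lborel_unit_cube: "emeasure lborel (cbox 0 One :: 'a::euclidean_space set) = 1"
  by (simp add: emeasure_lborel_cbox_eq)

lemma restrict_in_space_tuple_measure: "(\<lambda>i\<in>{..<n}. f i) \<in> space (tuple_measure n)"
  by (simp add: space_PiM)

text \<open>The choice behind \<open>correlation_function\<close> is only informative once some
  translation-invariant version is known to exist; \<open>\<rho>\<close> is that witness.\<close>

lemma correlation_function_spec:
  assumes "is_correlation_function P n \<rho>"
    and "\<forall>x \<in> space (tuple_measure n). \<forall>t. \<rho> (\<lambda>i\<in>{..<n}. x i + t) = \<rho> x"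
  shows "is_correlation_function P n (correlation_function P n)"
    and "x \<in> space (tuple_measure n) \<Longrightarrow>
      correlation_function P n (\<lambda>i\<in>{..<n}. x i + t) = correlation_function P n x"
proof -
  have "\<exists>\<rho>. is_correlation_function P n \<rho> \<and>
     (\<forall>x \<in> space (tuple_measure n). \<forall>t. \<rho> (\<lambda>i\<in>{..<n}. x i + t) = \<rho> x)"
    using assms by blast
  from someI_ex[OF this]
  have "is_correlation_function P n (correlation_function P n) \<and>
     (\<forall>x \<in> space (tuple_measure n). \<forall>t.
        correlation_function P n (\<lambda>i\<in>{..<n}. x i + t) = correlation_function P n x)"
    unfolding correlation_function_def .
  then show "is_correlation_function P n (correlation_function P n)"
    and "x \<in> space (tuple_measure n) \<Longrightarrow>
      correlation_function P n (\<lambda>i\<in>{..<n}. x i + t) = correlation_function P n x"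
    by blast+
qed

text \<open>Both sides equal the expected sum of \<open>G\<close> over distinct tuples. This is how
  two versions are compared.\<close>

lemma is_correlation_function_nn_integral_eq:
  assumes "is_correlation_function P n \<rho>" and "is_correlation_function P n \<rho>'"
    and "G \<in> borel_measurable (tuple_measure n)"
  shows "(\<integral>\<^sup>+x. G x * ennreal (\<rho> x) \<partial>tuple_measure n) = (\<integral>\<^sup>+x. G x * ennreal (\<rho>' x) \<partial>tuple_measure n)"
proof -
  have "(\<integral>\<^sup>+x. G x * ennreal (\<sigma> x) \<partial>tuple_measure n) =
      (\<integral>\<^sup>+\<gamma>. (\<integral>\<^sup>+x. G x \<partial>count_space (distinct_tuples n \<gamma>)) \<partial>P)"
    if "is_correlation_function P n \<sigma>" for \<sigma>
    using that assms(3) unfolding is_correlation_function_def by simp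
  then show ?thesis
    using assms(1,2) by simp
qed

text \<open>An invariant function of one point is constant, so the chosen version and
  \<open>\<rho>\<close> are two constants with the same integral over the unit cube.\<close>

lemma intensity_eq:
  fixes P :: "'a::euclidean_space set measure"
  assumes \<rho>: "is_correlation_function P 1 \<rho>"
    and c: "\<And>x. x \<in> space (tuple_measure 1) \<Longrightarrow> \<rho> x = c"
  shows "intensity P = c"
proof -
  interpret product_sigma_finite "\<lambda>_::nat. lborel :: 'a measure" ..
  let ?\<sigma> = "correlation_function P 1"
  have inv: "\<forall>x \<in> space (tuple_measure 1). \<forall>t. \<rho> (\<lambda>i\<in>{..<1}. x i + t) = \<rho> x"
    using c restrict_in_space_tuple_measure by metis
  have \<sigma>: "is_correlation_function P 1 ?\<sigma>"
    by (rule correlation_function_spec(1)[OF \<rho> inv])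
  have const: "?\<sigma> x = intensity P" if x: "x \<in> space (tuple_measure 1)" for x
  proof -
    \<comment> \<open>Translating by minus the point itself moves it to the origin, where
      \<open>intensity\<close> is read off.\<close>
    have "(\<lambda>i\<in>{..<1}. x i + (- x 0)) = (\<lambda>i\<in>{..<1}. 0)"
      by (auto simp: restrict_def)
    then show ?thesis
      using correlation_function_spec(2)[OF \<rho> inv x, of "- x 0"] by (simp add: intensity_def)
  qed
  define G :: "(nat \<Rightarrow> 'a) \<Rightarrow> ennreal" where "G x = indicator (cbox 0 One) (x 0)" for x
  have G [measurable]: "G \<in> borel_measurable (tuple_measure 1)"
    unfolding G_def by measurable
  have "{..<1} = {0::nat}"
    by auto
  then have G1: "(\<integral>\<^sup>+x. G x \<partial>tuple_measure 1) = 1"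
    unfolding G_def using product_nn_integral_singleton[of "indicator (cbox 0 One)" 0] by (simp add: emeasure_lborel_unit_cube)
  have "(\<integral>\<^sup>+x. G x * ennreal s \<partial>tuple_measure 1) = ennreal s" for s
    by (simp only: nn_integral_multc[OF G] G1 mult_1)
  moreover have "(\<integral>\<^sup>+x. G x * ennreal (\<rho> x) \<partial>tuple_measure 1) = (\<integral>\<^sup>+x. G x * ennreal c \<partial>tuple_measure 1)"
    by (intro nn_integral_cong) (simp add: c)
  moreover have "(\<integral>\<^sup>+x. G x * ennreal (?\<sigma> x) \<partial>tuple_measure 1) = (\<integral>\<^sup>+x. G x * ennreal (intensity P) \<partial>tuple_measure 1)"
    by (intro nn_integral_cong) (simp add: const del: One_nat_def)
  ultimately have "ennreal (intensity P) = ennreal c"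
    using is_correlation_function_nn_integral_eq[OF \<rho> \<sigma> G] by simp
  \<comment> \<open>\<open>ennreal\<close> sends every negative number to 0, so signs are needed to
    return to the reals.\<close>
  moreover have "0 \<le> c" "0 \<le> intensity P"
    using \<rho> \<sigma> c const restrict_in_space_tuple_measure[of "\<lambda>_. 0" 1]
    unfolding is_correlation_function_def by metis+
  ultimately show ?thesis
    by simp
qed

text \<open>The unit cube localises the second point, so that functions of the difference can be tested
  against \<open>\<rho>\<^sup>(\<^sup>2\<^sup>)\<close>; this carries almost everywhere statements from pairs of points to \<open>\<real>\<^sup>d\<close>.\<close>

lemma nn_integral_tuple_2_difference:
  fixes f :: "'a::euclidean_space \<Rightarrow> ennreal"
  assumes [measurable]: "f \<in> borel_measurable borel"
  shows "(\<integral>\<^sup>+x. f (x 0 - x 1) * indicator (cbox 0 One) (x 1) \<partial>tuple_measure 2) = (\<integral>\<^sup>+z. f z \<partial>lborel)"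
proof -
  interpret product_sigma_finite "\<lambda>_::nat. lborel :: 'a measure" ..
  have trans: "(\<integral>\<^sup>+x. f (x - y) \<partial>lborel) = (\<integral>\<^sup>+z. f z \<partial>lborel)" for y
  proof -
    have "(\<integral>\<^sup>+z. f z \<partial>lborel) = (\<integral>\<^sup>+z. f z \<partial>distr lborel borel ((+) (- y)))"
      by (simp add: lborel_distr_plus)
    also have "\<dots> = (\<integral>\<^sup>+x. f (x - y) \<partial>lborel)"
      by (simp add: nn_integral_distr)
    finally show ?thesis ..
  qed
  have "{..<2} = {0, 1::nat}"
    by auto
  then have "(\<integral>\<^sup>+x. f (x 0 - x 1) * indicator (cbox 0 One) (x 1) \<partial>tuple_measure 2) =
      (\<integral>\<^sup>+z. f (fst z - snd z) * indicator (cbox 0 One) (snd z) \<partial>(lborel \<Otimes>\<^sub>M lborel))"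
    using product_nn_integral_pair[of "\<lambda>x y. f (x - y) * indicator (cbox 0 One) y" 0 1] by simp
  \<comment> \<open>With \<open>y\<close> held fixed outside, translation invariance removes it from
    the inner integral, and the cube contributes its measure 1.\<close>
  also have "\<dots> = (\<integral>\<^sup>+y. (\<integral>\<^sup>+x. f (x - y) * indicator (cbox 0 One) y \<partial>lborel) \<partial>lborel)"
    by (subst lborel_pair.nn_integral_snd[symmetric]) simp_all
  also have "\<dots> = (\<integral>\<^sup>+y. (\<integral>\<^sup>+z. f z \<partial>lborel) * indicator (cbox 0 One) (y :: 'a) \<partial>lborel)"
    by (intro nn_integral_cong) (simp add: nn_integral_multc trans)
  also have "\<dots> = (\<integral>\<^sup>+z. f z \<partial>lborel)"
    by (simp add: nn_integral_cmult_indicator emeasure_lborel_unit_cube)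
  finally show ?thesis .
qed

text \<open>The chosen version is unspecified beyond invariance, so agreement is only almost
  everywhere. Invariance makes it a function of the difference of the two points, and two densities
  with equal integrals over all Borel sets agree almost everywhere.\<close>

lemma pair_correlation_AE_eq:
  fixes P :: "'a::euclidean_space set measure" and g :: "'a \<Rightarrow> real"
  assumes \<rho>: "is_correlation_function P 2 \<rho>"
    and g: "\<And>x. x \<in> space (tuple_measure 2) \<Longrightarrow> \<rho> x = g (x 0 - x 1)"
  shows "pair_correlation P \<in> borel_measurable borel"
    and "AE x in lborel. pair_correlation P x = g x"
proof -
  \<comment> \<open>The measurable section x \<mapsto> (x, 0). Through it
    \<open>pair_correlation P\<close> and \<open>g\<close> inherit measurability and nonnegativity
    from the two versions on pairs.\<close>
  define pt :: "'a \<Rightarrow> nat \<Rightarrow> 'a" where "pt x = (\<lambda>i\<in>{..<2}. if i = 0 then x else 0)" for x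
  have pt_space: "pt x \<in> space (tuple_measure 2)" for x
    by (simp add: pt_def space_PiM)
  have [measurable]: "pt \<in> borel \<rightarrow>\<^sub>M tuple_measure 2"
    unfolding pt_def by (rule measurable_restrict) simp
  let ?\<sigma> = "correlation_function P 2"
  have inv: "\<forall>x \<in> space (tuple_measure 2). \<forall>t. \<rho> (\<lambda>i\<in>{..<2}. x i + t) = \<rho> x"
    using g[OF restrict_in_space_tuple_measure] g by simp
  have \<sigma>: "is_correlation_function P 2 ?\<sigma>"
    by (rule correlation_function_spec(1)[OF \<rho> inv])
  have f: "?\<sigma> x = pair_correlation P (x 0 - x 1)" if x: "x \<in> space (tuple_measure 2)" for x
  proof -
    \<comment> \<open>Translation by minus the second point brings the pair to the form (difference,
      0).\<close>
    have "(\<lambda>i\<in>{..<2}. x i + (- x 1)) = (\<lambda>i\<in>{..<2}. if i = 0 then x 0 - x 1 else 0)"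
      by (auto simp: restrict_def less_2_cases_iff)
    then show ?thesis
      using correlation_function_spec(2)[OF \<rho> inv x, of "- x 1"] unfolding pair_correlation_def
      by (simp only:)
  qed
  have [measurable]: "\<rho> \<in> borel_measurable (tuple_measure 2)" "?\<sigma> \<in> borel_measurable (tuple_measure 2)"
    using \<rho> \<sigma> unfolding is_correlation_function_def by blast+
  have "pair_correlation P x = ?\<sigma> (pt x)" "g x = \<rho> (pt x)" for x
    using g[OF pt_space] by (simp_all add: pair_correlation_def pt_def)
  then have eq: "pair_correlation P = (\<lambda>x. ?\<sigma> (pt x))" "g = (\<lambda>x. \<rho> (pt x))"
    by auto
  show meas_f [measurable]: "pair_correlation P \<in> borel_measurable borel"
    unfolding eq by measurable
  have meas_g [measurable]: "g \<in> borel_measurable borel"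
    unfolding eq by measurable
  have nonneg: "0 \<le> pair_correlation P x" "0 \<le> g x" for x
    using \<rho> \<sigma> pt_space unfolding eq is_correlation_function_def by blast+
  have "AE x in lborel. ennreal (pair_correlation P x) = ennreal (g x)"
  proof (rule sigma_finite_measure.density_unique2[OF sigma_finite_lborel])
    fix A :: "'a set" assume "A \<in> sets lborel"
    then have [measurable]: "A \<in> sets borel"
      by simp
    define G :: "(nat \<Rightarrow> 'a) \<Rightarrow> ennreal"
      where "G x = indicator A (x 0 - x 1) * indicator (cbox 0 One) (x 1)" for x
    have [measurable]: "(\<lambda>x. x 0) \<in> tuple_measure 2 \<rightarrow>\<^sub>M (borel :: 'a measure)"
        "(\<lambda>x. x 1) \<in> tuple_measure 2 \<rightarrow>\<^sub>M (borel :: 'a measure)"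
      using measurable_component_singleton[of _ "{..<2}" "\<lambda>_. lborel :: 'a measure"] by simp_all
    have G: "G \<in> borel_measurable (tuple_measure 2)"
      unfolding G_def by measurable
    have *: "(\<integral>\<^sup>+x. G x * ennreal (s x) \<partial>tuple_measure 2) = (\<integral>\<^sup>+z\<in>A. ennreal (h z) \<partial>lborel)"
      if s: "\<And>x. x \<in> space (tuple_measure 2) \<Longrightarrow> s x = h (x 0 - x 1)"
        and [measurable]: "h \<in> borel_measurable borel" for s h
    proof -
      have "(\<integral>\<^sup>+x. G x * ennreal (s x) \<partial>tuple_measure 2) =
          (\<integral>\<^sup>+x. (ennreal (h (x 0 - x 1)) * indicator A (x 0 - x 1)) * indicator (cbox 0 One) (x 1) \<partial>tuple_measure 2)"
        by (intro nn_integral_cong) (simp add: s G_def mult_ac)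
      also have "\<dots> = (\<integral>\<^sup>+z\<in>A. ennreal (h z) \<partial>lborel)"
        by (rule nn_integral_tuple_2_difference) simp
      finally show ?thesis .
    qed
    show "(\<integral>\<^sup>+z\<in>A. ennreal (pair_correlation P z) \<partial>lborel) = (\<integral>\<^sup>+z\<in>A. ennreal (g z) \<partial>lborel)"
      using is_correlation_function_nn_integral_eq[OF \<sigma> \<rho> G] *[OF f meas_f] *[OF g meas_g] by simp
  qed simp_all
  then show "AE x in lborel. pair_correlation P x = g x"
    using nonneg by simp
qed

lemma det_mat_2:
  "Determinant.det (Matrix.mat 2 2 f) = f (0, 0) * f (1, 1) - f (0, 1) * (f (1, 0) :: 'b::comm_ring_1)"
proof -
  let ?A = "Matrix.mat 2 2 f"
  \<comment> \<open>Deleting row \<open>i\<close> and column 0 leaves the entry of column 1 in the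
    other row, \<open>1 - i\<close>.\<close>
  have "mat_delete ?A i 0 = Matrix.mat 1 1 (\<lambda>_. f (1 - i, 1))" if "i < 2" for i
    using that by (intro eq_matI) (auto simp: mat_delete_def less_2_cases_iff)
  then have cof: "cofactor ?A i 0 = (- 1) ^ i * f (1 - i, 1)" if "i < 2" for i
    using that by (simp add: cofactor_def det_single)
  have "Determinant.det ?A = (\<Sum>i<2. ?A $$ (i, 0) * cofactor ?A i 0)"
    by (rule laplace_expansion_column) simp_all
  also have "{..<2} = {0, 1::nat}"
    by auto
  finally show ?thesis
    by (simp add: cof algebra_simps)
qed

section \<open>The determinantal process\<close>

text \<open>The indicator is real, so conjugation only reverses the phase. This turns the
  off-diagonal product K(x) K(-x) of the 2 by 2 determinant into |K(x)|^2.\<close>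

lemma cnj_fourier_indicator: "fourier_indicator E (- x) = cnj (fourier_indicator E x)"
  unfolding fourier_indicator_def
  by (subst Bochner_Integration.integral_cnj[symmetric])
    (simp add: cis_cnj del: Bochner_Integration.integral_cnj)

text \<open>A Lebesgue set differs from a Borel set by a null set, which neither the kernel nor any
  overlap can see. The equalities hold at every point, so the results for Borel sets
  transfer.\<close>

lemma borel_approximation:
  fixes E :: "'a::euclidean_space set"
  assumes "E \<in> sets lebesgue"
  obtains S where "S \<in> sets borel" "emeasure lborel S = emeasure lebesgue E"
    "projection_kernel E = fourier_indicator S"
    "\<And>\<xi>. measure lebesgue ((\<lambda>x. x + \<xi>) ` E \<inter> E) = overlap S \<xi>"
proof -
  obtain S N N' where E: "E = S \<union> N" and N: "N \<subseteq> N'" "N' \<in> null_sets lborel" and S: "S \<in> sets lborel"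
    using assms by (rule sets_completionE)
  have [measurable]: "S \<in> sets borel"
    using S by simp
  have null: "T \<in> null_sets lebesgue" if "T \<subseteq> T'" "T' \<in> null_sets lborel" for T T' :: "'a set"
    using that null_sets_completion_subset null_sets_completionI by metis
  show thesis
  proof
    show "S \<in> sets borel"
      by simp
    show "emeasure lborel S = emeasure lebesgue E"
      unfolding E using S null[OF N] by (simp add: emeasure_Un_null_set)
    have "AE \<eta> in lebesgue. \<eta> \<notin> N"
      by (intro AE_not_in null[OF N])
    then have AE: "AE \<eta> in lebesgue. indicator E \<eta> = (indicator S \<eta> :: real)"
      by eventually_elim (simp add: E indicator_def)
    show "projection_kernel E = fourier_indicator S"
    proof
      fix x :: 'a
      have e: "exp (2 * of_real pi * \<i> * of_real (x \<bullet> \<eta>)) = cis (2 * pi * (x \<bullet> \<eta>))" for \<eta> :: 'a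
        by (simp add: cis_conv_exp mult_ac)
      have [measurable]: "(\<lambda>\<eta>::'a. cis (2 * pi * (x \<bullet> \<eta>))) \<in> borel_measurable lebesgue"
        by (rule measurable_completion) measurable
      have [measurable]: "E \<in> sets lebesgue" "S \<in> sets lebesgue"
        using assms by simp_all
      have "projection_kernel E x = (\<integral>\<eta>. indicator S \<eta> *\<^sub>R cis (2 * pi * (x \<bullet> \<eta>)) \<partial>lebesgue)"
        unfolding projection_kernel_def set_lebesgue_integral_def e
      proof (rule integral_cong_AE)
        show "AE \<eta> in lebesgue. indicator E \<eta> *\<^sub>R cis (2 * pi * (x \<bullet> \<eta>)) =
            indicator S \<eta> *\<^sub>R cis (2 * pi * (x \<bullet> \<eta>))"
          using AE by eventually_elim simp
      qed measurable
      also have "\<dots> = (\<integral>\<eta>. indicator S \<eta> *\<^sub>R cis (2 * pi * (x \<bullet> \<eta>)) \<partial>lborel)"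
        by (rule integral_completion) measurable
      finally show "projection_kernel E x = fourier_indicator S x"
        by (simp add: fourier_indicator_def scaleR_conv_of_real)
    qed
    fix \<xi> :: 'a
    have im: "(\<lambda>x. x + \<xi>) ` T = {x. x - \<xi> \<in> T}" for T :: "'a set"
      by (auto simp: image_iff) (metis diff_add_cancel)
    define B where "B = {x. x - \<xi> \<in> S} \<inter> S"
    have "(\<lambda>x. x - \<xi>) -` S \<in> sets borel"
      by (rule measurable_sets_borel[of _ borel]) simp_all
    then have B: "B \<in> sets borel"
      by (simp add: B_def vimage_def)
    define R where "R = ((\<lambda>x. x + \<xi>) ` E \<inter> E) - B"
    \<comment> \<open>If \<open>x\<close> and \<open>x - \<xi>\<close> lie in \<open>E\<close> but
      not both in \<open>S\<close>, one of them lies in \<open>N\<close>, hence in the Borel null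
      set \<open>N'\<close>.\<close>
    have "R \<subseteq> N' \<union> {x. x - \<xi> \<in> N'}"
      using N(1) by (auto simp: R_def B_def E im)
    then have R: "R \<in> null_sets lebesgue"
      by (rule null) (intro null_sets.Un N null_sets_translation)
    have "(\<lambda>x. x + \<xi>) ` E \<inter> E = B \<union> R"
      by (auto simp: R_def B_def E im)
    then have "measure lebesgue ((\<lambda>x. x + \<xi>) ` E \<inter> E) = measure lborel B"
      using B R by (simp add: measure_Un_null_set)
    also have "\<dots> = (\<integral>x. indicator B x \<partial>lborel)"
      by simp
    also have "\<dots> = overlap S \<xi>"
      unfolding overlap_def by (intro Bochner_Integration.integral_cong) (auto simp: B_def indicator_def)
    finally show "measure lebesgue ((\<lambda>x. x + \<xi>) ` E \<inter> E) = overlap S \<xi>" .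
  qed
qed

section \<open>From the one-point and two-point determinants to the structure factor\<close>

theorem proposition3p1:
  fixes E :: "'a::euclidean_space set" and P :: "'a set measure"
  assumes "E \<in> sets lebesgue" and "E = uminus ` E" and "emeasure lebesgue E = 1"
    and "point_process P" and "stationary P"
    and "determinantal P (projection_kernel E)"
  shows "integrable lebesgue (truncated_pair_correlation P) \<and>
    (\<forall>\<xi>. structure_factor P \<xi>
        = complex_of_real (1 - measure lebesgue ((\<lambda>x. x + \<xi>) ` E \<inter> E))) \<and>
    structure_factor P 0 = 0 \<and>
    (\<forall>\<xi>. \<xi> \<noteq> 0 \<longrightarrow> structure_factor P \<xi> \<in> \<real> \<and> 0 < Re (structure_factor P \<xi>))"
proof -
  obtain S where S: "S \<in> sets borel" and "emeasure lborel S = emeasure lebesgue E"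
    and K: "projection_kernel E = fourier_indicator S"
    and overlap: "\<And>\<xi>. measure lebesgue ((\<lambda>x. x + \<xi>) ` E \<inter> E) = overlap S \<xi>"
    by (rule borel_approximation[OF assms(1)]) blast
  then have "emeasure lborel S = 1"
    using assms(3) by simp
  then have fin: "emeasure lborel S < \<infinity>" and measure_S: "measure lborel S = 1"
    by (simp_all add: measure_def)
  note [measurable] = measurable_fourier_indicator[OF S fin]
  define w where "w x = (norm (fourier_indicator S x))\<^sup>2" for x
  \<comment> \<open>K(0) is the measure of \<open>S\<close>; it is the diagonal entry of every
    determinant.\<close>
  have K0: "fourier_indicator S 0 = 1"
    using S fin measure_S by (simp add: fourier_indicator_def)
  have "intensity P = 1"
  proof -
    obtain \<rho> where \<rho>: "is_correlation_function P 1 \<rho>"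
      and det: "\<And>x. x \<in> space (tuple_measure 1) \<Longrightarrow> complex_of_real (\<rho> x) =
        Determinant.det (Matrix.mat 1 1 (\<lambda>(i, j). projection_kernel E (x i - x j)))"
      using assms(6) unfolding determinantal_def by (metis order_refl)
    have "\<rho> x = 1" if "x \<in> space (tuple_measure 1)" for x
    proof -
      have "complex_of_real (\<rho> x) = 1"
        unfolding det[OF that] by (subst det_single) (simp_all add: K K0)
      then show ?thesis
        by simp
    qed
    then show ?thesis
      by (rule intensity_eq[OF \<rho>])
  qed
  obtain \<rho> where \<rho>: "is_correlation_function P 2 \<rho>"
    and det: "\<And>x. x \<in> space (tuple_measure 2) \<Longrightarrow> complex_of_real (\<rho> x) =
      Determinant.det (Matrix.mat 2 2 (\<lambda>(i, j). projection_kernel E (x i - x j)))"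
    using assms(6) unfolding determinantal_def by (metis one_le_numeral)
  have \<rho>_eq: "\<rho> x = 1 - w (x 0 - x 1)" if "x \<in> space (tuple_measure 2)" for x
  proof -
    have "complex_of_real (\<rho> x) = 1 - fourier_indicator S (x 0 - x 1) * fourier_indicator S (- (x 0 - x 1))"
      unfolding det[OF that] by (simp add: det_mat_2 K K0)
    also have "\<dots> = complex_of_real (1 - w (x 0 - x 1))"
      unfolding cnj_fourier_indicator w_def by (simp only: complex_norm_square of_real_diff of_real_1)
    finally show ?thesis
      by (simp only: of_real_eq_iff)
  qed
  have pair: "pair_correlation P \<in> borel_measurable borel"
      "AE x in lborel. pair_correlation P x = 1 - w x"
    by (rule pair_correlation_AE_eq[OF \<rho> \<rho>_eq]; assumption)+
  note [measurable] = pair(1)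
  have trunc: "truncated_pair_correlation P = (\<lambda>x. pair_correlation P x - 1)"
    by (auto simp: truncated_pair_correlation_def \<open>intensity P = 1\<close>)
  have [measurable]: "truncated_pair_correlation P \<in> borel_measurable borel"
    unfolding trunc by measurable
  have [measurable]: "w \<in> borel_measurable borel"
    unfolding w_def by measurable
  have AE: "AE x in lborel. truncated_pair_correlation P x = - w x"
    using pair(2) by eventually_elim (simp add: trunc)
  have w: "integrable lborel w"
    unfolding w_def by (rule integrable_norm_fourier_indicator[OF S fin])
  have "integrable lborel (truncated_pair_correlation P) \<longleftrightarrow> integrable lborel (\<lambda>x. - w x)"
    using AE by (intro integrable_cong_AE) simp_all
  then have int: "integrable lebesgue (truncated_pair_correlation P)"
    using w by (simp add: integrable_completion)
  \<comment> \<open>The Fourier integral depends only on the almost everywhere class of the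
    truncated pair correlation, so the formula holds at every \<open>\<xi>\<close>. As the intensity
    is 1, the structure factor is 1 plus that integral.\<close>
  have S_eq: "structure_factor P \<xi> = complex_of_real (1 - overlap S \<xi>)" for \<xi>
  proof -
    have e: "exp (- 2 * of_real pi * \<i> * of_real (x \<bullet> \<xi>)) = cis (- 2 * pi * (x \<bullet> \<xi>))" for x
      by (simp add: cis_conv_exp mult_ac)
    have "fourier_transform (\<lambda>x. of_real (truncated_pair_correlation P x)) \<xi> =
        (\<integral>x. cis (- 2 * pi * (x \<bullet> \<xi>)) * of_real (truncated_pair_correlation P x) \<partial>lborel)"
      unfolding fourier_transform_def e by (rule integral_completion) measurable
    also have "\<dots> = (\<integral>x. - (of_real (w x) * cis (- 2 * pi * (x \<bullet> \<xi>))) \<partial>lborel)"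
    proof (rule integral_cong_AE)
      show "AE x in lborel. cis (- 2 * pi * (x \<bullet> \<xi>)) * of_real (truncated_pair_correlation P x) =
          - (of_real (w x) * cis (- 2 * pi * (x \<bullet> \<xi>)))"
        using AE by eventually_elim simp
    qed measurable
    also have "\<dots> = - complex_of_real (overlap S \<xi>)"
      unfolding w_def by (simp only: Bochner_Integration.integral_minus fourier_inversion[OF S fin])
    finally show ?thesis
      by (simp add: structure_factor_def \<open>intensity P = 1\<close>)
  qed
  have "structure_factor P 0 = 0"
    by (simp add: S_eq overlap_0[OF S fin] measure_S)
  moreover have "structure_factor P \<xi> \<in> \<real> \<and> 0 < Re (structure_factor P \<xi>)" if "\<xi> \<noteq> 0" for \<xi>
    using overlap_less[OF S fin that] by (simp add: S_eq measure_S)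
  ultimately show ?thesis
    using int S_eq overlap by simp
qed

end
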